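(* Let $d\ge1$ and $1\le r\le d$ be integers. There exist constants $C>0$ and $n_0$ (depending only on $d$ and $r$) such that for all odd integers $n\ge n_0$, $$\overleftarrow{m}(\mathbb{T}_n^d,r)\le\frac{1}{r}\binom{d}{r-1}n^{r-1}+Cn^{r-2}.$$
   Context: The $d$-dimensional torus $\mathbb{T}_n^d$ is the graph with vertex set $[n]^d=\{1,\dots,n\}^d$, where two vertices are adjacent iff they differ in exactly one coordinate $j$ and in that coordinate $x_j-x'_j\equiv\pm1\pmod n$. A configuration assigns each vertex a state active (1) or inactive (0); its size is the number of active vertices. In reversible $r$-bootstrap percolation, in each round, simultaneously, every vertex becomes active if it has at least $r$ active neighbors and inactive otherwise. A dynamo is an initial configuration such that from some time on all vertices are active in all subsequent rounds. $\overleftarrow{m}(G,r)$ is the minimum size of a dynamo under reversible $r$-bootstrap percolation on $G$. *)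

theory Defs
  imports Complex_Main "HOL-Library.FuncSet" "HOL-Number_Theory.Cong"
begin

text \<open>A finite graph is given by its vertex set \<open>V\<close> and adjacency relation \<open>E\<close>;
  a configuration is given by its set \<open>A \<subseteq> V\<close> of active vertices, so its size is \<open>card A\<close>.\<close>

definition rev_step :: "'a set \<Rightarrow> ('a \<Rightarrow> 'a \<Rightarrow> bool) \<Rightarrow> nat \<Rightarrow> 'a set \<Rightarrow> 'a set" where
  "rev_step V E r A = {v \<in> V. r \<le> card {u \<in> V. E v u \<and> u \<in> A}}"

definition rev_dynamo :: "'a set \<Rightarrow> ('a \<Rightarrow> 'a \<Rightarrow> bool) \<Rightarrow> nat \<Rightarrow> 'a set \<Rightarrow> bool" where
  "rev_dynamo V E r A \<longleftrightarrow> A \<subseteq> V \<and> (\<exists>t0. \<forall>t\<ge>t0. (rev_step V E r ^^ t) A = V)"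

text \<open>Meaningful only if a dynamo exists; \<open>rev_dynamo_torus_verts\<close> below shows that this
  is the case for the tori with \<open>n \<ge> 3\<close> and \<open>r \<le> d\<close>.\<close>

definition min_rev_dynamo :: "'a set \<Rightarrow> ('a \<Rightarrow> 'a \<Rightarrow> bool) \<Rightarrow> nat \<Rightarrow> nat" where
  "min_rev_dynamo V E r = (LEAST k. \<exists>A. rev_dynamo V E r A \<and> card A = k)"

definition torus_verts :: "nat \<Rightarrow> nat \<Rightarrow> (nat \<Rightarrow> nat) set" where
  "torus_verts d n = {1..d} \<rightarrow>\<^sub>E {1..n}"

definition torus_adj :: "nat \<Rightarrow> nat \<Rightarrow> (nat \<Rightarrow> nat) \<Rightarrow> (nat \<Rightarrow> nat) \<Rightarrow> bool" where
  "torus_adj d n x y \<longleftrightarrow>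
     (\<exists>j\<in>{1..d}. x j \<noteq> y j \<and> (\<forall>i\<in>{1..d} - {j}. x i = y i) \<and>
        ([int (x j) - int (y j) = 1] (mod int n) \<or> [int (x j) - int (y j) = -1] (mod int n)))"

lemma finite_torus_verts: "finite (torus_verts d n)"
  unfolding torus_verts_def by (rule finite_PiE) auto

lemma torus_degree_ge:
  assumes "n \<ge> 3" "x \<in> torus_verts d n"
  shows "d \<le> card {y \<in> torus_verts d n. torus_adj d n x y}"
proof -
  define s where "s = (\<lambda>j. x(j := if x j = n then 1 else x j + 1))"
  have ne: "s j j \<noteq> x j" for j using assms(1) by (simp add: s_def)
  have inj: "inj_on s {1..d}"
  proof (rule inj_onI)
    fix i j assume "s i = s j"
    then have "s j i \<noteq> x i" using ne[of i] by simp
    then show "i = j" by (simp add: s_def split: if_splits)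
  qed
  have "s ` {1..d} \<subseteq> {y \<in> torus_verts d n. torus_adj d n x y}"
  proof
    fix y assume "y \<in> s ` {1..d}"
    then obtain j where j: "j \<in> {1..d}" "y = s j" by blast
    have xj: "x j \<in> {1..n}" using assms(2) j(1) unfolding torus_verts_def by (blast dest: PiE_mem)
    have "s j j \<in> {1..n}" using xj assms(1) by (auto simp: s_def)
    then have "y \<in> torus_verts d n"
      using assms(2) j unfolding torus_verts_def s_def
      by (auto simp: PiE_iff extensional_def)
    moreover have "[int (x j) - int (s j j) = -1] (mod int n)"
      by (auto simp: s_def cong_iff_dvd_diff)
    then have "torus_adj d n x y"
      unfolding torus_adj_def using j ne[of j]
      by (intro bexI[of _ j]) (auto simp: s_def)
    ultimately show "y \<in> {y \<in> torus_verts d n. torus_adj d n x y}" by blast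
  qed
  then have "card (s ` {1..d}) \<le> card {y \<in> torus_verts d n. torus_adj d n x y}"
    by (intro card_mono) (auto simp: finite_torus_verts)
  then show ?thesis using card_image[OF inj] by simp
qed

lemma rev_dynamo_torus_verts:
  assumes "n \<ge> 3" "r \<le> d"
  shows "rev_dynamo (torus_verts d n) (torus_adj d n) r (torus_verts d n)"
proof -
  let ?V = "torus_verts d n"
  have "rev_step ?V (torus_adj d n) r ?V = ?V"
  proof -
    have "r \<le> card {u \<in> ?V. torus_adj d n v u \<and> u \<in> ?V}" if "v \<in> ?V" for v
    proof -
      have "{u \<in> ?V. torus_adj d n v u \<and> u \<in> ?V} = {u \<in> ?V. torus_adj d n v u}" by blast
      then show ?thesis using torus_degree_ge[OF assms(1) that] assms(2) by simp
    qed
    then show ?thesis unfolding rev_step_def by blast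
  qed
  then have "(rev_step ?V (torus_adj d n) r ^^ t) ?V = ?V" for t
    by (induction t) auto
  then show ?thesis unfolding rev_dynamo_def by blast
qed

end

theory Submission imports Defs begin

text \<open>Watch each point of the lattice \<open>\<int>\<^sup>d\<close> covering the torus only at times of its own parity. If
  every point of a finite set \<open>X\<close> has at least \<open>r\<close> neighbours in \<open>X\<close>, then its even points,
  projected to the torus, sustain themselves, and from then on the reversible process acts on the
  lattice like irreversible \<open>r\<close>-bootstrap percolation started from \<open>X\<close>. Once the box \<open>[0, n]\<^sup>d\<close>
  is filled so is everything, because \<open>n\<close> is odd; and the box is filled as soon as its
  \<open>(r - 1)\<close>-dimensional coordinate faces at the origin are, because a point with \<open>r\<close> nonzero
  coordinates has \<open>r\<close> neighbours closer to the origin. In such a face with coordinate set \<open>S\<close>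
  and a distinguished \<open>l \<in> S\<close> take the points whose coordinate sum over \<open>S - {l}\<close> is \<open>0\<close> or \<open>-1\<close>
  modulo \<open>r\<close>, up to a translation: each has \<open>r\<close> neighbours of the same kind, and their even half has
  density \<open>1 / r\<close>. Together with a thickened \<open>(r - 2)\<close>-dimensional skeleton, which costs only
  \<open>O(n\<^bsup>r-2\<^esup>)\<close>, they fill the face.\<close>

section \<open>Unit steps, support and projection on the integer lattice\<close>

definition shift :: "(nat \<Rightarrow> int) \<Rightarrow> nat \<times> int \<Rightarrow> nat \<Rightarrow> int" where
  "shift x q = x(fst q := x (fst q) + snd q)"

definition dirs :: "nat \<Rightarrow> (nat \<times> int) set" where
  "dirs d = {1..d} \<times> {-1, 1}"

text \<open>Neighbours are counted through directions: distinct directions lead to distinct lattice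
  points and, for \<open>n\<close> \<ge> 3, to distinct torus vertices.\<close>

definition supported :: "nat \<Rightarrow> nat \<Rightarrow> (nat \<Rightarrow> int) set \<Rightarrow> (nat \<Rightarrow> int) \<Rightarrow> bool" where
  "supported d r U x \<longleftrightarrow> (\<exists>Q\<subseteq>dirs d. r \<le> card Q \<and> (\<forall>q\<in>Q. shift x q \<in> U))"

definition proj :: "nat \<Rightarrow> nat \<Rightarrow> (nat \<Rightarrow> int) \<Rightarrow> nat \<Rightarrow> nat" where
  "proj d n x = (\<lambda>i\<in>{1..d}. nat (x i mod int n) + 1)"

text \<open>Both 0 and \<open>n\<close> are included although they are congruent modulo
  \<open>n\<close>: a coordinate 0 can be traded for \<open>n\<close> when the translation vector is
  adjusted by one.\<close>

definition box :: "nat \<Rightarrow> nat set \<Rightarrow> (nat \<Rightarrow> int) set" where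
  "box n S = {x. (\<forall>i. i \<notin> S \<longrightarrow> x i = 0) \<and> (\<forall>i\<in>S. 0 \<le> x i \<and> x i \<le> int n)}"

lemma finite_dirs: "finite (dirs d)"
  by (simp add: dirs_def)

lemma shift_simps: "shift x (i, e) i = x i + e" "j \<noteq> i \<Longrightarrow> shift x (i, e) j = x j"
  by (simp_all add: shift_def)

lemma sum_shift:
  assumes "finite A"
  shows "(\<Sum>j\<in>A. f j * shift x (i, e) j) = (\<Sum>j\<in>A. f j * x j) + (if i \<in> A then f i * e else 0)"
proof -
  have "(\<Sum>j\<in>A. f j * shift x (i, e) j) = (\<Sum>j\<in>A. f j * x j + (if j = i then f i * e else 0))"
    by (rule sum.cong) (auto simp: shift_def algebra_simps)
  then show ?thesis using assms by (simp add: sum.distrib)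
qed

lemma sum_shift1:
  "finite A \<Longrightarrow> (\<Sum>j\<in>A. shift x (i, e) j) = (\<Sum>j\<in>A. x j) + (if i \<in> A then e else 0)"
  using sum_shift[of A "\<lambda>_. 1" x i e] by simp

lemma supported_mono: "supported d r U x \<Longrightarrow> U \<subseteq> W \<Longrightarrow> supported d r W x"
  unfolding supported_def by blast

text \<open>A function vanishing outside \<open>I\<close> is determined by its restriction to
  \<open>I\<close>, so the set embeds in a finite product.\<close>

lemma card_finite_support_le:
  fixes B :: "nat \<Rightarrow> int set"
  assumes "finite I" "\<And>i. i \<in> I \<Longrightarrow> finite (B i)"
  defines "W \<equiv> {x. (\<forall>i. i \<notin> I \<longrightarrow> x i = 0) \<and> (\<forall>i\<in>I. x i \<in> B i)}"
  shows "finite W \<and> card W \<le> (\<Prod>i\<in>I. card (B i))"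
proof -
  have inj: "inj_on (\<lambda>x. restrict x I) W"
  proof (rule inj_onI)
    fix x y assume a: "x \<in> W" "y \<in> W" "restrict x I = restrict y I"
    show "x = y"
    proof
      fix i show "x i = y i"
        using a(1,2) fun_cong[OF a(3), of i] by (cases "i \<in> I") (auto simp: W_def)
    qed
  qed
  have sub: "(\<lambda>x. restrict x I) ` W \<subseteq> PiE I B" by (auto simp: W_def)
  have fin: "finite (PiE I B)" using assms(1,2) by (rule finite_PiE)
  have "finite W" using finite_imageD[OF finite_subset[OF sub fin] inj] .
  moreover have "card W \<le> card (PiE I B)"
    using card_inj_on_le[OF inj sub fin] .
  ultimately show ?thesis using card_PiE[OF assms(1), of B] by simp
qed

section \<open>Lifting to the integer lattice\<close>

lemma proj_in: "n > 0 \<Longrightarrow> proj d n x \<in> torus_verts d n"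
proof -
  assume n: "n > 0"
  have "nat (x i mod int n) + 1 \<in> {1..n}" for i
  proof -
    have "x i mod int n < int n" "0 \<le> x i mod int n" using n by simp_all
    then have "nat (x i mod int n) < n" by linarith
    then show ?thesis by simp
  qed
  then show ?thesis unfolding proj_def torus_verts_def by auto
qed

text \<open>The two steps differ by at most 2 < \<open>n\<close>. On shorter cycles opposite steps
  would coincide.\<close>

lemma mod_shift_neq:
  fixes a e f :: int
  assumes "n \<ge> 3" "e \<in> {-1, 0, 1}" "f \<in> {-1, 0, 1}" "(a + e) mod int n = (a + f) mod int n"
  shows "e = f"
proof -
  have "int n dvd e - f" using assms(4) by (simp add: mod_eq_dvd_iff)
  moreover have "\<bar>e - f\<bar> < int n" using assms by auto
  ultimately show ?thesis using dvd_imp_le_int[of "e - f" "int n"] by auto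
qed

lemma proj_shift_inj:
  assumes "n \<ge> 3"
  shows "inj_on (\<lambda>q. proj d n (shift x q)) (dirs d)"
proof (rule inj_onI)
  fix q q' assume q: "q \<in> dirs d" "q' \<in> dirs d" "proj d n (shift x q) = proj d n (shift x q')"
  obtain i e where ie: "q = (i, e)" by fastforce
  obtain j f where jf: "q' = (j, f)" by fastforce
  have i: "i \<in> {1..d}" "e \<in> {-1, 1}" "f \<in> {-1, 1}" using q ie jf by (auto simp: dirs_def)
  have "nat (shift x q i mod int n) = nat (shift x q' i mod int n)"
    using fun_cong[OF q(3), of i] i by (simp add: proj_def)
  then have "shift x q i mod int n = shift x q' i mod int n" using assms by (simp add: nat_eq_iff2)
  \<comment> \<open>It suffices to look at coordinate \<open>i\<close>, which the second direction
    moves by \<open>f\<close> if it uses the same coordinate and by 0 otherwise.\<close>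
  then have "(x i + e) mod int n = (x i + (if i = j then f else 0)) mod int n"
    by (auto simp: ie jf shift_def)
  then have "e = (if i = j then f else 0)"
    by (rule mod_shift_neq[OF assms, rotated 2]) (use i in auto)
  then show "q = q'" using i ie jf by (auto split: if_splits)
qed

lemma proj_shift_adj:
  assumes "n \<ge> 3" "q \<in> dirs d"
  shows "torus_adj d n (proj d n x) (proj d n (shift x q))"
proof -
  obtain i e where ie: "q = (i, e)" by fastforce
  have i: "i \<in> {1..d}" "e \<in> {-1, 1}" using assms ie by (auto simp: dirs_def)
  have a: "int (proj d n x i) = x i mod int n + 1"
    "int (proj d n (shift x q) i) = (x i + e) mod int n + 1"
    using i assms by (auto simp: proj_def ie shift_def)
  have ne: "(x i + e) mod int n \<noteq> x i mod int n"
    using mod_shift_neq[OF assms(1), of e 0 "x i"] i by auto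
  have "[x i mod int n + 1 - ((x i + e) mod int n + 1) = x i + 1 - (x i + e + 1)] (mod int n)"
    by (intro cong_diff cong_add) auto
  then have c: "[int (proj d n x i) - int (proj d n (shift x q) i) = - e] (mod int n)"
    unfolding a by simp
  show ?thesis unfolding torus_adj_def
  proof (intro bexI[of _ i] conjI ballI)
    show "proj d n x i \<noteq> proj d n (shift x q) i" using a ne by auto
    show "proj d n x j = proj d n (shift x q) j" if "j \<in> {1..d} - {i}" for j
      using that by (simp add: proj_def ie shift_def)
    show "[int (proj d n x i) - int (proj d n (shift x q) i) = 1] (mod int n) \<or>
      [int (proj d n x i) - int (proj d n (shift x q) i) = - 1] (mod int n)"
      using c i by auto
  qed (rule i)
qed

text \<open>The projection is injective on the neighbours of a point, so \<open>r\<close> supporting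
  directions yield \<open>r\<close> distinct active neighbours in the torus.\<close>

lemma proj_in_rev_step:
  assumes "n \<ge> 3" "supported d r {y. proj d n y \<in> B} x"
  shows "proj d n x \<in> rev_step (torus_verts d n) (torus_adj d n) r B"
proof -
  obtain Q where Q: "Q \<subseteq> dirs d" "r \<le> card Q" "\<forall>q\<in>Q. proj d n (shift x q) \<in> B"
    using assms(2) unfolding supported_def by auto
  let ?N = "{u \<in> torus_verts d n. torus_adj d n (proj d n x) u \<and> u \<in> B}"
  have "card Q \<le> card ?N"
  proof (rule card_inj_on_le)
    show "inj_on (\<lambda>q. proj d n (shift x q)) Q"
      using proj_shift_inj[OF assms(1)] Q(1) by (rule inj_on_subset)
    show "(\<lambda>q. proj d n (shift x q)) ` Q \<subseteq> ?N"
      using Q proj_shift_adj[OF assms(1)] proj_in[of n d] assms(1) by auto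
  qed (simp add: finite_torus_verts)
  then show ?thesis unfolding rev_step_def using Q(2) proj_in[of n d x] assms(1) by simp
qed

text \<open>Even translations are given by \<open>trans\<close>. For odd ones, induct on the
  coordinate sum: a zero coordinate can be replaced by \<open>n\<close>, which makes the translation
  even; without zero coordinates, all \<open>d\<close> \<ge> \<open>r\<close> points one step back
  stay in the box and are covered by induction.\<close>

lemma box_to_all_translates:
  assumes d: "r \<le> d" "d \<ge> 1"
    and closed: "\<And>x. supported d r U x \<Longrightarrow> x \<in> U"
    and trans: "\<And>x m. x \<in> U \<Longrightarrow> even (\<Sum>i\<in>{1..d}. m i) \<Longrightarrow> (\<lambda>i. x i + int n * m i) \<in> U"
    and box: "box n {1..d} \<subseteq> U"
    and y: "y \<in> box n {1..d}"
  shows "(\<lambda>i. y i + int n * m i) \<in> U"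
proof (cases "even (\<Sum>i\<in>{1..d}. m i)")
  case True
  then show ?thesis using trans box y by blast
next
  case odd: False
  show ?thesis using y
  proof (induction "nat (\<Sum>i\<in>{1..d}. y i)" arbitrary: y rule: less_induct)
    case less
    have yb: "i \<in> {1..d} \<Longrightarrow> 0 \<le> y i \<and> y i \<le> int n" "i \<notin> {1..d} \<Longrightarrow> y i = 0" for i
      using less.prems by (auto simp: box_def)
    show ?case
    proof (cases "\<exists>i\<in>{1..d}. y i = 0")
      case True
      then obtain i where i: "i \<in> {1..d}" "y i = 0" by blast
      have "(\<Sum>j\<in>{1..d}. shift m (i, -1) j) = (\<Sum>j\<in>{1..d}. m j) - 1"
        using i by (subst sum_shift1) auto
      then have ev: "even (\<Sum>j\<in>{1..d}. shift m (i, -1) j)" using odd by simp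
      have "y(i := int n) \<in> box n {1..d}" using i yb by (auto simp: box_def)
      then have "(\<lambda>j. (y(i := int n)) j + int n * shift m (i, -1) j) \<in> U"
        using trans ev box by blast
      also have "(\<lambda>j. (y(i := int n)) j + int n * shift m (i, -1) j) = (\<lambda>j. y j + int n * m j)"
        using i by (auto simp: shift_def algebra_simps)
      finally show ?thesis .
    next
      case False
      have "shift (\<lambda>j. y j + int n * m j) (i, -1) \<in> U" if i: "i \<in> {1..d}" for i
      proof -
        have p: "1 \<le> y i" using i yb(1)[of i] False by force
        have "(\<Sum>j\<in>{1..d}. shift y (i, -1) j) = (\<Sum>j\<in>{1..d}. y j) - 1"
          using i by (subst sum_shift1) auto
        moreover have "(\<Sum>j\<in>{1..d}. y j) \<ge> y i"
          using i yb by (intro member_le_sum) auto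
        ultimately have lt: "nat (\<Sum>j\<in>{1..d}. shift y (i, -1) j) < nat (\<Sum>j\<in>{1..d}. y j)"
          using p by linarith
        have "0 \<le> y i - 1 \<and> y i - 1 \<le> int n" using p yb(1)[OF i] by linarith
        then have "shift y (i, -1) \<in> box n {1..d}"
          using i less.prems by (auto simp: box_def shift_def)
        from less.hyps[OF lt this]
        have "(\<lambda>j. shift y (i, -1) j + int n * m j) \<in> U" .
        moreover have "(\<lambda>j. shift y (i, -1) j + int n * m j) = shift (\<lambda>j. y j + int n * m j) (i, -1)"
          by (auto simp: shift_def)
        ultimately show ?thesis by simp
      qed
      then show ?thesis
        using d by (intro closed) (auto simp: supported_def dirs_def card_cartesian_product
            intro!: exI[of _ "{1..d} \<times> {-1}"])
    qed
  qed
qed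

lemma rev_dynamo_of_stable:
  assumes n: "n \<ge> 3" "odd n" and d: "r \<le> d" "d \<ge> 1"
    and stable: "\<And>x. x \<in> X \<Longrightarrow> supported d r X x"
    and perc: "\<And>U. X \<subseteq> U \<Longrightarrow> (\<And>x. supported d r U x \<Longrightarrow> x \<in> U) \<Longrightarrow> box n {1..d} \<subseteq> U"
  shows "rev_dynamo (torus_verts d n) (torus_adj d n) r
    (proj d n ` {x \<in> X. even (\<Sum>i\<in>{1..d}. x i)})"
proof -
  let ?A0 = "proj d n ` {x \<in> X. even (\<Sum>i\<in>{1..d}. x i)}"
  define V where "V = torus_verts d n"
  define A where "A = (\<lambda>t. (rev_step V (torus_adj d n) r ^^ t) ?A0)"
  define p where "p = (\<lambda>x::nat \<Rightarrow> int. \<Sum>i\<in>{1..d}. x i)"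
  have AS: "A (Suc t) = rev_step V (torus_adj d n) r (A t)" for t by (simp add: A_def)
  have AV: "A t \<subseteq> V" for t
    using n by (cases t) (auto simp: A_def rev_step_def V_def proj_in)
  \<comment> \<open>A unit step and a round both flip parity, so a point watched at time
    \<open>t + 1\<close> depends on neighbours watched at time \<open>t\<close>.\<close>
  have p_shift: "even (p (shift x q) + int t) \<longleftrightarrow> even (p x + int (Suc t))" if q: "q \<in> dirs d" for x q t
  proof -
    obtain i e where "q = (i, e)" "i \<in> {1..d}" "e \<in> {-1, 1}"
      using q unfolding dirs_def by blast
    then have "p (shift x q) = p x + e" "odd e" unfolding p_def by (auto simp: sum_shift1)
    then show ?thesis by auto
  qed
  \<comment> \<open>Points whose projection is active from some time on, at the times of their
    parity. This set will contain \<open>X\<close> and be closed under support.\<close>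
  define U where "U = {x. \<exists>T. \<forall>t\<ge>T. even (p x + int t) \<longrightarrow> proj d n x \<in> A t}"
  have step: "proj d n x \<in> A (Suc t)"
    if "Q \<subseteq> dirs d" "r \<le> card Q" "\<forall>q\<in>Q. proj d n (shift x q) \<in> A t" for Q x t
    unfolding AS V_def using that by (intro proj_in_rev_step[OF n(1)]) (auto simp: supported_def)
  have "\<forall>x\<in>X. even (p x + int t) \<longrightarrow> proj d n x \<in> A t" for t
  proof (induction t)
    case 0
    then show ?case by (auto simp: A_def p_def)
  next
    case (Suc t)
    show ?case
    proof (intro ballI impI)
      fix x assume x: "x \<in> X" "even (p x + int (Suc t))"
      obtain Q where Q: "Q \<subseteq> dirs d" "r \<le> card Q" "\<forall>q\<in>Q. shift x q \<in> X"
        using stable[OF x(1)] unfolding supported_def by blast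
      have "\<forall>q\<in>Q. proj d n (shift x q) \<in> A t"
        using Q Suc.IH x(2) p_shift by blast
      then show "proj d n x \<in> A (Suc t)" using step Q by blast
    qed
  qed
  then have XU: "X \<subseteq> U" unfolding U_def by blast
  have closed: "x \<in> U" if sup: "supported d r U x" for x
  proof -
    obtain Q where Q: "Q \<subseteq> dirs d" "r \<le> card Q" "\<forall>q\<in>Q. shift x q \<in> U"
      using sup unfolding supported_def by blast
    then have "\<forall>q\<in>Q. \<exists>T. \<forall>t\<ge>T. even (p (shift x q) + int t) \<longrightarrow> proj d n (shift x q) \<in> A t"
      by (auto simp: U_def)
    then obtain T where T: "\<And>q t. q \<in> Q \<Longrightarrow> t \<ge> T q \<Longrightarrow> even (p (shift x q) + int t) \<Longrightarrow>
        proj d n (shift x q) \<in> A t"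
      by metis
    have fin: "finite (T ` Q)" using Q(1) finite_dirs finite_subset by blast
    \<comment> \<open>One round after the last of finitely many waiting times; inserting 0 keeps
      \<open>Max\<close> defined for empty \<open>Q\<close>.\<close>
    have "proj d n x \<in> A t" if t: "t \<ge> Suc (Max (insert 0 (T ` Q)))" "even (p x + int t)" for t
    proof -
      obtain t' where t': "t = Suc t'" using t by (cases t) auto
      have "T q \<le> t'" if "q \<in> Q" for q
        using Max_ge[of "insert 0 (T ` Q)" "T q"] fin that t t' by auto
      then have "\<forall>q\<in>Q. proj d n (shift x q) \<in> A t'"
        using T p_shift Q(1) t(2) t' by blast
      then show ?thesis using step Q t' by blast
    qed
    then show ?thesis unfolding U_def by blast
  qed
  have trans: "(\<lambda>i. x i + int n * m i) \<in> U" if "x \<in> U" "even (\<Sum>i\<in>{1..d}. m i)" for x m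
  proof -
    have "p (\<lambda>i. x i + int n * m i) = p x + int n * (\<Sum>i\<in>{1..d}. m i)"
      by (simp add: p_def sum.distrib sum_distrib_left)
    moreover have "proj d n (\<lambda>i. x i + int n * m i) = proj d n x"
      by (simp add: proj_def)
    ultimately show ?thesis using that by (simp add: U_def)
  qed
  have all: "(\<lambda>i. y i + int n * m i) \<in> U" if "y \<in> box n {1..d}" for y m
    by (rule box_to_all_translates[OF d closed trans perc[OF XU closed] that])
  have ev: "\<exists>T. \<forall>t\<ge>T. v \<in> A t" if v: "v \<in> V" for v
  proof -
    define y where "y = (\<lambda>i. if i \<in> {1..d} then int (v i) - 1 else 0)"
    have vb: "v i \<in> {1..n}" if "i \<in> {1..d}" for i
      using v that unfolding V_def torus_verts_def by (rule PiE_mem)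
    have y: "y \<in> box n {1..d}" using vb by (force simp: y_def box_def)
    \<comment> \<open>Translating by the odd number \<open>n\<close> along one axis gives a second
      lift of \<open>v\<close> of the opposite parity. The two lifts together cover all late
      times.\<close>
    define m where "m = (\<lambda>i::nat. if i = 1 then 1 else 0 :: int)"
    have pr: "proj d n y = v"
    proof
      fix i show "proj d n y i = v i"
        using vb[of i] v by (cases "i \<in> {1..d}")
          (auto simp: proj_def y_def V_def torus_verts_def PiE_def extensional_def)
    qed
    have pr': "proj d n (\<lambda>i. y i + int n * m i) = v" using pr by (simp add: proj_def)
    have "(\<Sum>i\<in>{1..d}. m i) = 1" using d by (simp add: m_def)
    then have pm: "p (\<lambda>i. y i + int n * m i) = p y + int n"
      by (simp add: p_def sum.distrib flip: sum_distrib_left)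
    have "y \<in> U" using all[OF y, of "\<lambda>_. 0"] by simp
    then obtain T1 where T1: "\<And>t. t \<ge> T1 \<Longrightarrow> even (p y + int t) \<Longrightarrow> v \<in> A t"
      unfolding U_def pr mem_Collect_eq by blast
    obtain T2 where T2: "\<And>t. t \<ge> T2 \<Longrightarrow> even (p y + int n + int t) \<Longrightarrow> v \<in> A t"
      using all[OF y, of m] unfolding U_def mem_Collect_eq pr' pm by blast
    have "v \<in> A t" if "t \<ge> max T1 T2" for t
      using T1[of t] T2[of t] that n(2) by (cases "even (p y + int t)") auto
    then show ?thesis by blast
  qed
  then obtain T where T: "\<And>v t. v \<in> V \<Longrightarrow> t \<ge> T v \<Longrightarrow> v \<in> A t" by metis
  have fin: "finite (T ` V)" by (simp add: V_def finite_torus_verts)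
  have "A t = V" if "t \<ge> Max (insert 0 (T ` V))" for t
  proof -
    have "T v \<le> t" if "v \<in> V" for v
      using Max_ge[of "insert 0 (T ` V)" "T v"] fin that \<open>t \<ge> _\<close> by simp
    then show ?thesis using T AV by blast
  qed
  then have "\<exists>t0. \<forall>t\<ge>t0. A t = V" by blast
  moreover have "?A0 \<subseteq> V" using AV[of 0] by (simp add: A_def)
  ultimately show ?thesis unfolding rev_dynamo_def A_def V_def by simp
qed


section \<open>Percolation in the lattice\<close>

text \<open>Induction on the coordinate sum: a point with fewer than \<open>r\<close> nonzero
  coordinates lies in a flat, and any other can be lowered in at least \<open>r\<close>
  coordinates.\<close>

lemma flats_to_box:
  assumes r: "1 \<le> r" "r \<le> d"
    and closed: "\<And>x. supported d r U x \<Longrightarrow> x \<in> U"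
    and flats: "\<And>S. S \<subseteq> {1..d} \<Longrightarrow> card S = r - 1 \<Longrightarrow> box n S \<subseteq> U"
  shows "box n {1..d} \<subseteq> U"
proof
  fix y assume "y \<in> box n {1..d}"
  then show "y \<in> U"
  proof (induction "nat (\<Sum>i\<in>{1..d}. y i)" arbitrary: y rule: less_induct)
    case less
    have yb: "i \<in> {1..d} \<Longrightarrow> 0 \<le> y i \<and> y i \<le> int n" "i \<notin> {1..d} \<Longrightarrow> y i = 0" for i
      using less.prems by (auto simp: box_def)
    define P where "P = {i \<in> {1..d}. y i \<noteq> 0}"
    have P: "P \<subseteq> {1..d}" "finite P" by (auto simp: P_def)
    show ?case
    proof (cases "card P \<le> r - 1")
      case True
      have "r - 1 \<le> card {1..d}" using r by simp
      then obtain S where S: "P \<subseteq> S" "S \<subseteq> {1..d}" "card S = r - 1"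
        using exists_subset_between[OF True _ P(1)] by blast
      have "y \<in> box n S" using S yb by (auto simp: box_def P_def)
      then show ?thesis using flats S by blast
    next
      case False
      have "shift y (i, -1) \<in> U" if i: "i \<in> P" for i
      proof -
        have id: "i \<in> {1..d}" using i P by blast
        have p: "1 \<le> y i" using i yb(1)[of i] by (auto simp: P_def)
        have "(\<Sum>j\<in>{1..d}. shift y (i, -1) j) = (\<Sum>j\<in>{1..d}. y j) - 1"
          using id by (subst sum_shift1) auto
        moreover have "(\<Sum>j\<in>{1..d}. y j) \<ge> y i"
          using id yb by (intro member_le_sum) auto
        ultimately have lt: "nat (\<Sum>j\<in>{1..d}. shift y (i, -1) j) < nat (\<Sum>j\<in>{1..d}. y j)"
          using p by linarith
        have "0 \<le> y i - 1 \<and> y i - 1 \<le> int n" using p yb(1)[OF id] by linarith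
        then have "shift y (i, -1) \<in> box n {1..d}"
          using id less.prems by (auto simp: box_def shift_def)
        then show ?thesis using less.hyps[OF lt] by blast
      qed
      then show ?thesis using False P
        by (intro closed) (auto simp: supported_def dirs_def card_cartesian_product
            intro!: exI[of _ "P \<times> {-1}"])
    qed
  qed
qed

section \<open>Self-sustaining sets in the coordinate faces\<close>

definition colour :: "nat \<Rightarrow> nat set \<Rightarrow> nat \<Rightarrow> int \<Rightarrow> (nat \<Rightarrow> int) \<Rightarrow> int" where
  "colour r S l s x = ((\<Sum>i\<in>S - {l}. x i) + s) mod int r"

text \<open>The colour ignores coordinate \<open>l\<close>, so moving along \<open>l\<close>
  preserves it. The two colours kept are cyclically adjacent. The phase \<open>s\<close> is left
  free, to be chosen by averaging.\<close>

definition pattern :: "nat \<Rightarrow> nat \<Rightarrow> nat set \<Rightarrow> nat \<Rightarrow> int \<Rightarrow> (nat \<Rightarrow> int) set" where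
  "pattern n r S l s = {x. (\<forall>i. i \<notin> S \<longrightarrow> x i = 0) \<and> (\<forall>i\<in>S. 1 \<le> x i \<and> x i \<le> int n - 1) \<and>
     colour r S l s x \<in> {0, int r - 1}}"

text \<open>A thickened \<open>k\<close>-dimensional skeleton: all but at most \<open>k\<close>
  coordinates lie in -1, 0, \<open>n\<close>, \<open>n + 1\<close>. The outer layers -1 and
  \<open>n + 1\<close> give boundary values a partner.\<close>

definition frame :: "nat \<Rightarrow> nat \<Rightarrow> nat \<Rightarrow> (nat \<Rightarrow> int) set" where
  "frame d n k = {x. (\<forall>i. i \<notin> {1..d} \<longrightarrow> x i = 0) \<and> (\<forall>i\<in>{1..d}. -1 \<le> x i \<and> x i \<le> int n + 1) \<and>
     card {i \<in> {1..d}. 1 \<le> x i \<and> x i \<le> int n - 1} \<le> k}"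

lemma colour_shift:
  assumes "finite S"
  shows "colour r S l s (shift x (i, e)) =
    (colour r S l s x + (if i \<in> S - {l} then e else 0)) mod int r"
  using assms by (simp add: colour_def sum_shift1 mod_simps algebra_simps)

text \<open>Each coordinate offers one safe step: -1 and 0 are swapped, so are \<open>n\<close> and
  \<open>n + 1\<close>, and interior values go up. No step creates a new interior coordinate, so
  there are \<open>d\<close> \<ge> \<open>r\<close> supporting directions.\<close>

lemma frame_stable:
  assumes "r \<le> d" "n \<ge> 1" "x \<in> frame d n k"
  shows "supported d r (frame d n k) x"
proof -
  define e where "e = (\<lambda>i. if x i = 0 \<or> x i = int n + 1 then - 1 else 1 :: int)"
  let ?Q = "(\<lambda>i. (i, e i)) ` {1..d}"
  have xb: "i \<in> {1..d} \<Longrightarrow> -1 \<le> x i \<and> x i \<le> int n + 1" for i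
    using assms(3) by (auto simp: frame_def)
  have "shift x (i, e i) \<in> frame d n k" if i: "i \<in> {1..d}" for i
  proof -
    have "{j \<in> {1..d}. 1 \<le> shift x (i, e i) j \<and> shift x (i, e i) j \<le> int n - 1} \<subseteq>
        {j \<in> {1..d}. 1 \<le> x j \<and> x j \<le> int n - 1}"
      using xb[OF i] by (auto simp: shift_def e_def split: if_splits)
    then have "card {j \<in> {1..d}. 1 \<le> shift x (i, e i) j \<and> shift x (i, e i) j \<le> int n - 1} \<le>
        card {j \<in> {1..d}. 1 \<le> x j \<and> x j \<le> int n - 1}"
      by (intro card_mono) simp_all
    also have "\<dots> \<le> k" using assms(3) by (simp add: frame_def)
    finally have "card {j \<in> {1..d}. 1 \<le> shift x (i, e i) j \<and> shift x (i, e i) j \<le> int n - 1} \<le> k" .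
    moreover have "-1 \<le> x i + e i \<and> x i + e i \<le> int n + 1"
      using xb[OF i] by (auto simp: e_def)
    ultimately show ?thesis using assms(3) i unfolding frame_def by (auto simp: shift_def)
  qed
  moreover have "card ?Q = d" by (subst card_image) (auto simp: inj_on_def)
  moreover have "?Q \<subseteq> dirs d" by (auto simp: dirs_def e_def)
  ultimately show ?thesis unfolding supported_def using assms(1) by (intro exI[of _ ?Q]) auto
qed

text \<open>Coordinates outside \<open>S\<close> are 0 and one of the \<open>k + 1\<close> in
  \<open>S\<close> is extreme, which leaves at most \<open>k\<close> interior ones.\<close>

lemma box_boundary_in_frame:
  assumes "S \<subseteq> {1..d}" "card S = Suc k" "x \<in> box n S" "\<exists>i\<in>S. x i = 0 \<or> x i = int n"
  shows "x \<in> frame d n k"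
proof -
  have fin: "finite S" using assms(1) finite_subset by blast
  obtain i where i: "i \<in> S" "x i = 0 \<or> x i = int n" using assms(4) by blast
  have "{j \<in> {1..d}. 1 \<le> x j \<and> x j \<le> int n - 1} \<subseteq> S - {i}"
    using assms(3) i by (force simp: box_def)
  then have "card {j \<in> {1..d}. 1 \<le> x j \<and> x j \<le> int n - 1} \<le> card (S - {i})"
    using fin by (intro card_mono) auto
  then have c: "card {j \<in> {1..d}. 1 \<le> x j \<and> x j \<le> int n - 1} \<le> k" using i assms(2) by simp
  have "-1 \<le> x j \<and> x j \<le> int n + 1" for j
    using assms(3) by (cases "j \<in> S") (auto simp: box_def intro: order_trans[of _ 0] order_trans[of _ "int n"])
  then show ?thesis using c assms(1,3) by (auto simp: frame_def box_def)
qed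

lemma shift_pattern_in_box:
  assumes "\<forall>i. i \<notin> S \<longrightarrow> x i = 0" "\<forall>i\<in>S. 1 \<le> x i \<and> x i \<le> int n - 1" "i \<in> S" "e \<in> {-1, 1}"
  shows "shift x (i, e) \<in> box n S"
    and "(\<forall>j\<in>S. shift x (i, e) j \<noteq> 0 \<and> shift x (i, e) j \<noteq> int n) \<Longrightarrow>
      (\<forall>j. j \<notin> S \<longrightarrow> shift x (i, e) j = 0) \<and>
      (\<forall>j\<in>S. 1 \<le> shift x (i, e) j \<and> shift x (i, e) j \<le> int n - 1)"
proof -
  have *: "0 \<le> x i + e \<and> x i + e \<le> int n" using assms by fastforce
  show "shift x (i, e) \<in> box n S"
    using assms(1-3) * by (force simp: box_def shift_def)
  then show "(\<forall>j. j \<notin> S \<longrightarrow> shift x (i, e) j = 0) \<and>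
      (\<forall>j\<in>S. 1 \<le> shift x (i, e) j \<and> shift x (i, e) j \<le> int n - 1)"
    if "\<forall>j\<in>S. shift x (i, e) j \<noteq> 0 \<and> shift x (i, e) j \<noteq> int n"
    using that unfolding box_def by force
qed

text \<open>Both steps along \<open>l\<close> keep the colour, and each of the other
  \<open>r - 2\<close> coordinates has one step exchanging the colours 0 and \<open>r - 1\<close>:
  in total \<open>r\<close>. A step leaving the interior of the face lands in the frame.\<close>

lemma pattern_stable:
  assumes S: "S \<subseteq> {1..d}" "card S = r - 1" "l \<in> S" and r: "r \<ge> 2"
    and x: "x \<in> pattern n r S l s"
  shows "supported d r (pattern n r S l s \<union> frame d n (r - 2)) x"
proof -
  have fin: "finite S" using S(1) finite_subset by blast
  have xb: "\<forall>i. i \<notin> S \<longrightarrow> x i = 0" "\<forall>i\<in>S. 1 \<le> x i \<and> x i \<le> int n - 1"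
    and c: "colour r S l s x \<in> {0, int r - 1}"
    using x by (auto simp: pattern_def)
  define e where "e = (if colour r S l s x = 0 then -1 else 1 :: int)"
  define Q where "Q = {l} \<times> {-1, 1} \<union> (S - {l}) \<times> {e}"
  have "card Q = 2 + (r - 2)"
    unfolding Q_def using fin S by (subst card_Un_disjoint) (auto simp: card_cartesian_product)
  then have cQ: "card Q = r" using r by simp
  have "Q \<subseteq> dirs d" using S by (auto simp: Q_def dirs_def e_def)
  moreover have "shift x q \<in> pattern n r S l s \<union> frame d n (r - 2)" if q: "q \<in> Q" for q
  proof -
    obtain i f where q': "q = (i, f)" by fastforce
    have i: "i \<in> S" "f \<in> {-1, 1}" using q q' S by (auto simp: Q_def e_def split: if_splits)
    have m1: "- 1 mod int r = int r - 1" using r by (simp add: zmod_minus1)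
    have col: "colour r S l s (shift x (i, f)) \<in> {0, int r - 1}"
    proof (cases "i = l")
      case True
      then show ?thesis using c r by (auto simp: colour_shift[OF fin] m1)
    next
      case False
      then have "f = e" using q q' by (auto simp: Q_def)
      then show ?thesis using c r False i
        by (auto simp: colour_shift[OF fin] e_def m1)
    qed
    note b = shift_pattern_in_box[OF xb i]
    show ?thesis
    proof (cases "\<forall>j\<in>S. shift x (i, f) j \<noteq> 0 \<and> shift x (i, f) j \<noteq> int n")
      case True
      then show ?thesis using b(2) col q' by (simp add: pattern_def)
    next
      case False
      then show ?thesis
        using box_boundary_in_frame[OF S(1) _ b(1), of "r - 2"] S(2) r q' by auto
    qed
  qed
  ultimately show ?thesis unfolding supported_def using cQ by (intro exI[of _ Q]) simp
qed

text \<open>Order the points of the flat by the time \<open>x l + 2 (\<Sum> \<rho> i * x i) - c\<^sup>2\<close>, where \<open>\<rho>\<close> numbers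
  the directions \<open>i \<noteq> l\<close> by \<open>1, \<dots>, r - 2\<close> and \<open>c\<close> is the colour. A step \<open>+i\<close> changes the time by
  \<open>2 \<rho> i - 2 c - 1\<close> and a step \<open>-i\<close> by \<open>2 c - 1 - 2 \<rho> i\<close>, so the earlier neighbours are those in the
  directions \<open>+i\<close> with \<open>\<rho> i \<le> c\<close>, \<open>-i\<close> with \<open>\<rho> i \<ge> c\<close>, and \<open>-l\<close>: exactly \<open>r\<close> in total.\<close>

lemma pattern_fills_flat:
  assumes S: "S \<subseteq> {1..d}" "card S = r - 1" "l \<in> S" and r: "r \<ge> 2"
    and closed: "\<And>x. supported d r U x \<Longrightarrow> x \<in> U"
    and sub: "pattern n r S l s \<subseteq> U" "frame d n (r - 2) \<subseteq> U"
  shows "box n S \<subseteq> U"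
proof
  fix y assume yU: "y \<in> box n S"
  have fin: "finite S" using S(1) finite_subset by blast
  have "card (S - {l}) = card {1..r - 2}" using S fin by simp
  then obtain \<rho> where \<rho>: "bij_betw \<rho> (S - {l}) {1..r - 2}"
    using fin by (metis finite_same_card_bij finite_Diff finite_atLeastAtMost)
  have \<rho>b: "1 \<le> \<rho> i \<and> \<rho> i \<le> r - 2" if "i \<in> S - {l}" for i
    using bij_betwE[OF \<rho>] that by auto
  have \<rho>card: "card {i \<in> S - {l}. \<rho> i \<in> B} = card ({1..r - 2} \<inter> B)" for B
  proof -
    have "bij_betw \<rho> {i \<in> S - {l}. \<rho> i \<in> B} ({1..r - 2} \<inter> B)"
      using \<rho> unfolding bij_betw_def by (auto simp: inj_on_def)
    then show ?thesis by (rule bij_betw_same_card)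
  qed
  define col where "col = colour r S l s"
  define t where "t = (\<lambda>x. x l + 2 * (\<Sum>i\<in>S - {l}. int (\<rho> i) * x i) - (col x)\<^sup>2)"
  have colb: "0 \<le> col x \<and> col x \<le> int r - 1" for x
    using r pos_mod_bound[of "int r"] by (simp add: col_def colour_def)
  \<comment> \<open>Colours are below \<open>r\<close>, so adding \<open>r\<close> squared makes the
    time a natural number to induct on.\<close>
  have t_lower: "t x \<ge> - (int r)\<^sup>2" if "x \<in> box n S" for x
  proof -
    have "(col x)\<^sup>2 \<le> (int r)\<^sup>2" using colb[of x] by (intro power_mono) auto
    moreover have "0 \<le> x l" "0 \<le> (\<Sum>i\<in>S - {l}. int (\<rho> i) * x i)"
      using that S(3) by (auto simp: box_def intro!: sum_nonneg)
    ultimately show ?thesis unfolding t_def by linarith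
  qed
  show "y \<in> U" using yU
  proof (induction "nat (t y + (int r)\<^sup>2)" arbitrary: y rule: less_induct)
    case less
    have IH: "z \<in> U" if "z \<in> box n S" "t z < t y" for z
      using less.hyps[of z] that t_lower[OF that(1)] by auto
    show ?case
    proof (cases "(\<exists>i\<in>S. y i = 0 \<or> y i = int n) \<or> col y \<in> {0, int r - 1}")
      case True
      then show ?thesis
      proof (cases "\<exists>i\<in>S. y i = 0 \<or> y i = int n")
        case True
        then show ?thesis
          using box_boundary_in_frame[OF S(1) _ less.prems, of "r - 2"] S(2) r sub(2) by auto
      next
        case False
        have "1 \<le> y i \<and> y i \<le> int n - 1" if "i \<in> S" for i
          using False that less.prems by (force simp: box_def)
        then have "y \<in> pattern n r S l s"
          using True False less.prems by (auto simp: pattern_def box_def col_def)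
        then show ?thesis using sub by blast
      qed
    next
      case False
      have yb: "\<forall>i. i \<notin> S \<longrightarrow> y i = 0" "\<forall>i\<in>S. 1 \<le> y i \<and> y i \<le> int n - 1"
        using False less.prems by (force simp: box_def)+
      define c where "c = nat (col y)"
      have c: "col y = int c" "1 \<le> c" "c \<le> r - 2"
        using colb[of y] False by (auto simp: c_def)
      have r2: "int (r - 2) = int r - 2" using r by simp
      define Q where "Q = {(l, -1)} \<union> {i \<in> S - {l}. \<rho> i \<in> {..c}} \<times> {1}
        \<union> {i \<in> S - {l}. \<rho> i \<in> {c..}} \<times> {-1 :: int}"
      have "card Q = 1 + card {i \<in> S - {l}. \<rho> i \<in> {..c}} + card {i \<in> S - {l}. \<rho> i \<in> {c..}}"
        unfolding Q_def using fin
        by (subst card_Un_disjoint; (subst card_Un_disjoint)?) (auto simp: card_cartesian_product)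
      \<comment> \<open>The direction numbered \<open>c\<close> occurs with both signs, hence the
        count 1 + \<open>c\<close> + (\<open>r - 1 - c\<close>) = \<open>r\<close>.\<close>
      also have "\<dots> = 1 + card {1..c} + card {c..r - 2}"
      proof -
        have "{1..r - 2} \<inter> {..c} = {1..c}" "{1..r - 2} \<inter> {c..} = {c..r - 2}" using c by auto
        then show ?thesis by (simp only: \<rho>card)
      qed
      also have "\<dots> = r" using c r by simp
      finally have cQ: "card Q = r" .
      have QS: "i \<in> S \<and> e \<in> {-1, 1}" if "(i, e) \<in> Q" for i e
        using that S(3) by (auto simp: Q_def)
      have "shift y q \<in> U" if q: "q \<in> Q" for q
      proof -
        obtain i e where ie: "q = (i, e)" by fastforce
        have i: "i \<in> S" "e \<in> {-1, 1}" using QS q ie by auto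
        have "t (shift y (i, e)) < t y"
        proof (cases "i = l")
          case True
          then have "e = -1" using q ie by (auto simp: Q_def)
          have "col (shift y (i, e)) = col y"
            unfolding col_def colour_shift[OF fin] using True by (simp add: colour_def)
          then show ?thesis unfolding t_def using True fin \<open>e = -1\<close>
            by (simp add: sum_shift shift_simps)
        next
          case False
          \<comment> \<open>Since 1 \<le> \<open>c\<close> \<le> \<open>r - 2\<close>, the colour
            changes without wrapping around modulo \<open>r\<close>.\<close>
          have cs: "col (shift y (i, e)) = int c + e"
            unfolding col_def colour_shift[OF fin] using False i c r2
            by (auto simp: col_def[symmetric])
          have ts: "t (shift y (i, e)) = t y + 2 * int (\<rho> i) * e + (int c)\<^sup>2 - (int c + e)\<^sup>2"
            unfolding t_def cs c(1) using False i fin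
            by (simp add: sum_shift shift_simps algebra_simps)
          have "e = 1 \<and> \<rho> i \<le> c \<or> e = -1 \<and> c \<le> \<rho> i" using False q ie by (auto simp: Q_def)
          then show ?thesis unfolding ts by (auto simp: power2_eq_square algebra_simps)
        qed
        then show ?thesis using IH shift_pattern_in_box(1)[OF yb i] ie by blast
      qed
      moreover have "Q \<subseteq> dirs d" using QS S(1) unfolding dirs_def by fast
      ultimately have "supported d r U y" unfolding supported_def using cQ
        by (intro exI[of _ Q]) simp
      then show ?thesis by (rule closed)
    qed
  qed
qed

section \<open>Counting\<close>

text \<open>Choose a \<open>k\<close>-set containing the interior coordinates, in at most
  \<open>2 ^ d\<close> ways. Coordinates in it take \<open>n + 3\<close> \<le> \<open>4 * n\<close>
  values, all others at most 4.\<close>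

lemma card_frame_le:
  assumes "k \<le> d" "n \<ge> 1"
  shows "finite (frame d n k) \<and> card (frame d n k) \<le> 2 ^ d * 4 ^ d * n ^ k"
proof -
  define W where "W = (\<lambda>S. {x :: nat \<Rightarrow> int. (\<forall>i. i \<notin> {1..d} \<longrightarrow> x i = 0) \<and>
    (\<forall>i\<in>{1..d}. x i \<in> (if i \<in> S then {-1..int n + 1} else {-1, 0, int n, int n + 1}))})"
  define F where "F = {S. S \<subseteq> {1..d} \<and> card S = k}"
  have finF: "finite F" by (rule finite_subset[of _ "Pow {1..d}"]) (auto simp: F_def)
  have cF: "card F \<le> 2 ^ d" unfolding F_def
    by (subst n_subsets) (auto simp: binomial_le_pow2)
  have W: "finite (W S) \<and> card (W S) \<le> 4 ^ d * n ^ k" if S: "S \<in> F" for S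
  proof -
    let ?B = "\<lambda>i. if i \<in> S then {-1..int n + 1} else {-1, 0, int n, int n + 1}"
    have SS: "S \<subseteq> {1..d}" "card S = k" using S by (auto simp: F_def)
    have "(\<Prod>i\<in>{1..d}. card (?B i)) \<le> (\<Prod>i\<in>{1..d}. 4 * (if i \<in> S then n else 1))"
    proof (rule prod_mono)
      fix i assume "i \<in> {1..d}"
      have "card {-1, 0, int n, int n + 1} \<le> 4"
        by (intro card_insert_le_m1) auto
      moreover have "card {-1..int n + 1} \<le> 4 * n" using assms(2) by (simp add: nat_le_iff)
      ultimately show "0 \<le> card (?B i) \<and> card (?B i) \<le> 4 * (if i \<in> S then n else 1)"
        by (cases "i \<in> S") simp_all
    qed
    also have "\<dots> = 4 ^ d * (\<Prod>i\<in>{1..d}. if i \<in> S then n else 1)"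
      by (simp only: prod.distrib) simp
    also have "(\<Prod>i\<in>{1..d}. if i \<in> S then n else 1) = n ^ k"
      using SS by (simp add: prod.If_cases Int_absorb1)
    finally have "(\<Prod>i\<in>{1..d}. card (?B i)) \<le> 4 ^ d * n ^ k" .
    moreover have "finite (W S) \<and> card (W S) \<le> (\<Prod>i\<in>{1..d}. card (?B i))"
      unfolding W_def by (rule card_finite_support_le) simp_all
    ultimately show ?thesis by linarith
  qed
  have sub: "frame d n k \<subseteq> (\<Union>S\<in>F. W S)"
  proof
    fix x assume x: "x \<in> frame d n k"
    have "card {i \<in> {1..d}. 1 \<le> x i \<and> x i \<le> int n - 1} \<le> k" "k \<le> card {1..d}"
      using x assms by (simp_all add: frame_def)
    then obtain S where S: "{i \<in> {1..d}. 1 \<le> x i \<and> x i \<le> int n - 1} \<subseteq> S" "S \<subseteq> {1..d}" "card S = k"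
      using exists_subset_between[of "{i \<in> {1..d}. 1 \<le> x i \<and> x i \<le> int n - 1}" k "{1..d}"]
      by blast
    have "x \<in> W S" unfolding W_def
    proof (intro CollectI conjI ballI)
      fix i assume i: "i \<in> {1..d}"
      have "-1 \<le> x i" "x i \<le> int n + 1" using x i by (auto simp: frame_def)
      moreover have "i \<in> S \<or> x i < 1 \<or> x i > int n - 1" using S i by force
      ultimately show "x i \<in> (if i \<in> S then {-1..int n + 1} else {-1, 0, int n, int n + 1})"
        by auto
    qed (use x in \<open>auto simp: frame_def\<close>)
    then show "x \<in> (\<Union>S\<in>F. W S)" using S by (auto simp: F_def)
  qed
  have fin: "finite (\<Union>S\<in>F. W S)" using finF W by blast
  have "card (frame d n k) \<le> card (\<Union>S\<in>F. W S)" using card_mono[OF fin sub] .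
  also have "\<dots> \<le> (\<Sum>S\<in>F. card (W S))" using finF by (rule card_UN_le)
  also have "\<dots> \<le> (\<Sum>S\<in>F. 4 ^ d * n ^ k)" using W by (intro sum_mono) blast
  also have "\<dots> \<le> 2 ^ d * (4 ^ d * n ^ k)" using cF by simp
  finally show ?thesis using finite_subset[OF sub fin] by (simp add: algebra_simps)
qed

text \<open>As \<open>n - 1\<close> is even, pairing 1 with 2, 3 with 4, and so on along
  \<open>l\<close> is an involution of the grid that flips parity, so at most half of the points are
  even.\<close>

lemma card_even_grid:
  assumes "finite S" "l \<in> S" "odd n"
  defines "G \<equiv> {x :: nat \<Rightarrow> int. (\<forall>i. i \<notin> S \<longrightarrow> x i = 0) \<and> (\<forall>i\<in>S. 1 \<le> x i \<and> x i \<le> int n - 1)}"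
  shows "finite G \<and> 2 * card {x \<in> G. even (\<Sum>i\<in>S. x i)} \<le> n ^ card S"
proof -
  have G: "finite G \<and> card G \<le> (\<Prod>i\<in>S. card {1..int n - 1})"
    using card_finite_support_le[of S "\<lambda>_. {1..int n - 1}"] assms(1) unfolding G_def by simp
  have "(\<Prod>i\<in>S. card {1..int n - 1}) \<le> n ^ card S" by (simp add: power_mono)
  with G have cG: "card G \<le> n ^ card S" by linarith
  define E where "E = {x \<in> G. even (\<Sum>i\<in>S. x i)}"
  define e where "e = (\<lambda>a::int. if odd a then 1 else -1 :: int)"
  define f where "f = (\<lambda>x. shift x (l, e (x l)))"
  have e: "e (a + e a) = - e a" "odd (e a)" for a by (auto simp: e_def)
  have ff: "f (f x) = x" for x by (auto simp: f_def shift_def e)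
  have inj: "inj_on f E" by (metis ff inj_onI)
  have fG: "f x \<in> G" if "x \<in> G" for x
  proof -
    have "1 \<le> x l" "x l \<le> int n - 1" using that assms(2) by (auto simp: G_def)
    moreover have "even (int n - 1)" using assms(3) by simp
    ultimately have "1 \<le> x l + e (x l) \<and> x l + e (x l) \<le> int n - 1"
      unfolding e_def by (cases "x l = int n - 1"; cases "x l = 1") auto
    then show ?thesis using that assms(2) unfolding G_def f_def by (auto simp: shift_def)
  qed
  have "odd (\<Sum>i\<in>S. f x i)" if "x \<in> E" for x
    using that e(2)[of "x l"] assms(1,2) unfolding f_def by (simp add: sum_shift1 E_def)
  then have dis: "E \<inter> f ` E = {}" unfolding E_def by blast
  have fE: "finite E" using G by (simp add: E_def)
  have "2 * card E = card (E \<union> f ` E)"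
    using card_Un_disjoint[OF fE _ dis] fE card_image[OF inj] by simp
  also have "\<dots> \<le> card G" using G fG by (intro card_mono) (auto simp: E_def)
  finally show ?thesis using G cG unfolding E_def by simp
qed

text \<open>Double counting: each even interior point belongs to the pattern for at most two of the
  \<open>r\<close> phases. The total over all phases is thus at most \<open>2 * card E\<close> \<le>
  \<open>n ^ card S\<close>, and some phase gets at most the average.\<close>

lemma exists_sparse_pattern:
  assumes "finite S" "l \<in> S" "odd n" "r \<ge> 2"
  shows "\<exists>s. finite (pattern n r S l s) \<and>
    r * card {x \<in> pattern n r S l s. even (\<Sum>i\<in>S. x i)} \<le> n ^ card S"
proof -
  define G where "G = {x :: nat \<Rightarrow> int. (\<forall>i. i \<notin> S \<longrightarrow> x i = 0) \<and>
    (\<forall>i\<in>S. 1 \<le> x i \<and> x i \<le> int n - 1)}"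
  define E where "E = {x \<in> G. even (\<Sum>i\<in>S. x i)}"
  have G: "finite G" "2 * card E \<le> n ^ card S"
    using card_even_grid[OF assms(1-3)] unfolding G_def E_def by auto
  have fE: "finite E" using G by (simp add: E_def)
  have fin: "finite (pattern n r S l s)" for s
    by (rule finite_subset[OF _ G(1)]) (auto simp: pattern_def G_def)
  have pE: "{x \<in> pattern n r S l s. even (\<Sum>i\<in>S. x i)} = {x \<in> E. colour r S l s x \<in> {0, int r - 1}}" for s
    by (auto simp: pattern_def E_def G_def)
  let ?I = "{0..<int r}"
  have two: "card {s \<in> ?I. colour r S l s x \<in> {0, int r - 1}} \<le> 2" for x
  proof -
    let ?a = "\<Sum>i\<in>S - {l}. x i"
    \<comment> \<open>For a fixed point, the colour determines the phase modulo
      \<open>r\<close>.\<close>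
    have *: "s \<in> {(- ?a) mod int r, (- 1 - ?a) mod int r}"
      if "s \<in> ?I" "(?a + s) mod int r \<in> {0, int r - 1}" for s
    proof -
      have s: "s = ((?a + s) mod int r - ?a) mod int r" using that(1) by (simp add: mod_simps)
      have "(int r - 1 - ?a) mod int r = (- 1 - ?a) mod int r"
        using mod_add_self1[of "int r" "- 1 - ?a"] by (simp add: algebra_simps)
      then show ?thesis using that(2) s by (metis diff_0 insert_iff singletonD)
    qed
    have "{s \<in> ?I. colour r S l s x \<in> {0, int r - 1}} \<subseteq> {(- ?a) mod int r, (- 1 - ?a) mod int r}"
      unfolding colour_def by (rule subsetI, elim CollectE conjE) (rule *)
    then have "card {s \<in> ?I. colour r S l s x \<in> {0, int r - 1}}
      \<le> card {(- ?a) mod int r, (- 1 - ?a) mod int r}"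
      by (intro card_mono) simp_all
    also have "\<dots> \<le> 2" by (simp add: card_insert_if)
    finally show ?thesis .
  qed
  have "(\<Sum>s\<in>?I. card {x \<in> E. colour r S l s x \<in> {0, int r - 1}})
      = (\<Sum>s\<in>?I. \<Sum>x\<in>E. if colour r S l s x \<in> {0, int r - 1} then 1 else 0)"
    using fE by (simp add: sum.If_cases Int_def)
  also have "\<dots> = (\<Sum>x\<in>E. \<Sum>s\<in>?I. if colour r S l s x \<in> {0, int r - 1} then 1 else 0)"
    by (rule sum.swap)
  also have "\<dots> = (\<Sum>x\<in>E. card {s \<in> ?I. colour r S l s x \<in> {0, int r - 1}})"
    by (simp add: sum.If_cases Int_def)
  also have "\<dots> \<le> (\<Sum>x\<in>E. 2)" using two by (intro sum_mono) auto
  finally have tot: "(\<Sum>s\<in>?I. card {x \<in> E. colour r S l s x \<in> {0, int r - 1}}) \<le> n ^ card S"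
    using G(2) by simp
  have "\<exists>s\<in>?I. r * card {x \<in> E. colour r S l s x \<in> {0, int r - 1}} \<le> n ^ card S"
  proof (rule ccontr)
    assume "\<not> ?thesis"
    then have "(\<Sum>s\<in>?I. n ^ card S) < (\<Sum>s\<in>?I. r * card {x \<in> E. colour r S l s x \<in> {0, int r - 1}})"
      using assms(4) by (intro sum_strict_mono) (auto simp: not_le)
    also have "\<dots> = r * (\<Sum>s\<in>?I. card {x \<in> E. colour r S l s x \<in> {0, int r - 1}})"
      by (simp add: sum_distrib_left)
    also have "\<dots> \<le> r * n ^ card S" using tot by simp
    finally show False by simp
  qed
  then show ?thesis using fin unfolding pE by blast
qed

section \<open>The dynamo\<close>

lemma min_rev_dynamo_le:
  assumes "rev_dynamo V E r A"
  shows "min_rev_dynamo V E r \<le> card A"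
  unfolding min_rev_dynamo_def using assms by (intro Least_le) blast

text \<open>For \<open>r = 1\<close> the error term decays like 1 / \<open>n\<close>, so a single
  vertex must suffice. The two ends of an edge at the origin support each other, and only the origin
  is even.\<close>

lemma min_rev_dynamo_torus_1:
  assumes "n \<ge> 3" "odd n" "d \<ge> 1"
  shows "min_rev_dynamo (torus_verts d n) (torus_adj d n) 1 \<le> 1"
proof -
  define u where "u = (\<lambda>i::nat. if i = 1 then 1 else 0 :: int)"
  let ?X = "{\<lambda>_. 0, u}"
  have sh: "shift (\<lambda>_. 0) (1, 1) = u" "shift u (1, -1) = (\<lambda>_. 0)"
    by (auto simp: shift_def u_def)
  have "rev_dynamo (torus_verts d n) (torus_adj d n) 1
      (proj d n ` {x \<in> ?X. even (\<Sum>i\<in>{1..d}. x i)})"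
  proof (rule rev_dynamo_of_stable)
    fix x assume "x \<in> ?X"
    then show "supported d 1 ?X x"
    proof
      assume "x = (\<lambda>_. 0)"
      then show ?thesis using assms(3) sh unfolding supported_def
        by (intro exI[of _ "{(1, 1)}"]) (auto simp: dirs_def)
    next
      assume "x \<in> {u}"
      then show ?thesis using assms(3) sh unfolding supported_def
        by (intro exI[of _ "{(1, -1)}"]) (auto simp: dirs_def)
    qed
  next
    fix U assume U: "?X \<subseteq> U" "\<And>x. supported d 1 U x \<Longrightarrow> x \<in> U"
    show "box n {1..d} \<subseteq> U"
    proof (rule flats_to_box[OF _ _ U(2)])
      fix S :: "nat set" assume "S \<subseteq> {1..d}" "card S = 1 - 1"
      then have "S = {}" using finite_subset by fastforce
      then have "box n S = {\<lambda>_. 0}" by (auto simp: box_def)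
      then show "box n S \<subseteq> U" using U(1) by simp
    qed (use assms in auto)
  qed (use assms in auto)
  then have "min_rev_dynamo (torus_verts d n) (torus_adj d n) 1
      \<le> card (proj d n ` {x \<in> ?X. even (\<Sum>i\<in>{1..d}. x i)})"
    by (rule min_rev_dynamo_le)
  also have "{x \<in> ?X. even (\<Sum>i\<in>{1..d}. x i)} = {\<lambda>_. 0}"
    using assms(3) by (auto simp: u_def)
  finally show ?thesis by simp
qed

text \<open>The start is the frame with one sparse pattern per face. \<open>Min S\<close> is just
  some choice of distinguished coordinate, and multiplying by \<open>r\<close> keeps the bound in
  the natural numbers.\<close>

lemma min_rev_dynamo_torus_le:
  assumes n: "n \<ge> 3" "odd n" and r: "2 \<le> r" "r \<le> d"
  shows "r * min_rev_dynamo (torus_verts d n) (torus_adj d n) r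
    \<le> (d choose (r - 1)) * n ^ (r - 1) + r * (2 ^ d * 4 ^ d * n ^ (r - 2))"
proof -
  define F where "F = {S. S \<subseteq> {1..d} \<and> card S = r - 1}"
  have finF: "finite F" by (rule finite_subset[of _ "Pow {1..d}"]) (auto simp: F_def)
  have cF: "card F = d choose (r - 1)" unfolding F_def by (subst n_subsets) auto
  have F: "finite S" "Min S \<in> S" "S \<subseteq> {1..d}" "card S = r - 1" if "S \<in> F" for S
  proof -
    show S: "finite S" "S \<subseteq> {1..d}" "card S = r - 1"
      using that finite_subset by (auto simp: F_def)
    then have "S \<noteq> {}" using r by auto
    then show "Min S \<in> S" using S by simp
  qed
  have "\<forall>S\<in>F. \<exists>s. finite (pattern n r S (Min S) s) \<and>
      r * card {x \<in> pattern n r S (Min S) s. even (\<Sum>i\<in>S. x i)} \<le> n ^ (r - 1)"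
    using exists_sparse_pattern[OF F(1,2) n(2) r(1)] F(4) by metis
  then obtain s where s: "\<And>S. S \<in> F \<Longrightarrow>
      r * card {x \<in> pattern n r S (Min S) (s S). even (\<Sum>i\<in>S. x i)} \<le> n ^ (r - 1)"
    and sfin: "\<And>S. S \<in> F \<Longrightarrow> finite (pattern n r S (Min S) (s S))"
    by metis
  define P where "P = (\<lambda>S. pattern n r S (Min S) (s S))"
  define D where "D = frame d n (r - 2)"
  define X where "X = D \<union> (\<Union>S\<in>F. P S)"
  let ?ev = "\<lambda>x :: nat \<Rightarrow> int. even (\<Sum>i\<in>{1..d}. x i)"
  have "rev_dynamo (torus_verts d n) (torus_adj d n) r (proj d n ` {x \<in> X. ?ev x})"
  proof (rule rev_dynamo_of_stable)
    fix x assume "x \<in> X"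
    then consider "x \<in> D" | S where "S \<in> F" "x \<in> P S" by (auto simp: X_def)
    then show "supported d r X x"
    proof cases
      case 1
      then have "supported d r D x" unfolding D_def using n r by (intro frame_stable) auto
      then show ?thesis by (rule supported_mono) (auto simp: X_def)
    next
      case 2
      have "supported d r (P S \<union> D) x"
        using pattern_stable[OF F(3,4,2)[OF 2(1)] r(1)] 2(2) unfolding P_def D_def by blast
      then show ?thesis by (rule supported_mono) (use 2 in \<open>auto simp: X_def\<close>)
    qed
  next
    fix U assume U: "X \<subseteq> U" "\<And>x. supported d r U x \<Longrightarrow> x \<in> U"
    show "box n {1..d} \<subseteq> U"
    proof (rule flats_to_box[OF _ r(2) U(2)])
      fix S assume "S \<subseteq> {1..d}" "card S = r - 1"
      then have S: "S \<in> F" by (simp add: F_def)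
      show "box n S \<subseteq> U"
      proof (rule pattern_fills_flat[OF F(3,4,2)[OF S] r(1) U(2)])
        show "pattern n r S (Min S) (s S) \<subseteq> U" "frame d n (r - 2) \<subseteq> U"
          using U(1) S by (auto simp: X_def P_def D_def)
      qed
    qed (use r in auto)
  qed (use n r in auto)
  then have "min_rev_dynamo (torus_verts d n) (torus_adj d n) r \<le> card (proj d n ` {x \<in> X. ?ev x})"
    by (rule min_rev_dynamo_le)
  also have "\<dots> \<le> card {x \<in> X. ?ev x}"
  proof (rule card_image_le)
    have "finite X" using finF sfin card_frame_le[of "r - 2" d n] n r
      by (auto simp: X_def P_def D_def)
    then show "finite {x \<in> X. ?ev x}" by simp
  qed
  \<comment> \<open>The frame is counted with its odd points too, as it only affects the error
    term.\<close>
  also have "\<dots> \<le> card D + (\<Sum>S\<in>F. card {x \<in> P S. ?ev x})"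
  proof -
    have fD: "finite D" using card_frame_le[of "r - 2" d n] n r by (auto simp: D_def)
    have "card {x \<in> X. ?ev x} \<le> card (D \<union> (\<Union>S\<in>F. {x \<in> P S. ?ev x}))"
      using fD finF sfin by (intro card_mono) (auto simp: X_def P_def)
    also have "\<dots> \<le> card D + card (\<Union>S\<in>F. {x \<in> P S. ?ev x})" by (rule card_Un_le)
    also have "card (\<Union>S\<in>F. {x \<in> P S. ?ev x}) \<le> (\<Sum>S\<in>F. card {x \<in> P S. ?ev x})"
      using finF by (rule card_UN_le)
    finally show ?thesis by simp
  qed
  finally have "r * min_rev_dynamo (torus_verts d n) (torus_adj d n) r
      \<le> r * (card D + (\<Sum>S\<in>F. card {x \<in> P S. ?ev x}))" by simp
  also have "\<dots> = (\<Sum>S\<in>F. r * card {x \<in> P S. ?ev x}) + r * card D"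
    by (simp add: sum_distrib_left algebra_simps)
  also have "(\<Sum>S\<in>F. r * card {x \<in> P S. ?ev x}) \<le> (\<Sum>S\<in>F. n ^ (r - 1))"
  proof (rule sum_mono)
    fix S assume S: "S \<in> F"
    \<comment> \<open>Coordinates outside \<open>S\<close> vanish, so the parity in the torus
      dimension agrees with the parity within the face.\<close>
    have "(\<Sum>i\<in>{1..d}. x i) = (\<Sum>i\<in>S. x i)" if "x \<in> P S" for x
      using that F[OF S] by (intro sum.mono_neutral_right) (auto simp: P_def pattern_def)
    then have "{x \<in> P S. ?ev x} = {x \<in> P S. even (\<Sum>i\<in>S. x i)}" by auto
    then show "r * card {x \<in> P S. ?ev x} \<le> n ^ (r - 1)" using s[OF S] by (simp add: P_def)
  qed
  also have "(\<Sum>S\<in>F. n ^ (r - 1)) = (d choose (r - 1)) * n ^ (r - 1)" using cF by simp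
  also have "card D \<le> 2 ^ d * 4 ^ d * n ^ (r - 2)"
    using card_frame_le[of "r - 2" d n] n r by (simp add: D_def)
  finally show ?thesis by simp
qed

theorem theorem6:
  fixes d r :: nat
  assumes "d \<ge> 1" and "1 \<le> r" and "r \<le> d"
  shows "\<exists>(C::real) (n0::nat). C > 0 \<and>
    (\<forall>n\<ge>n0. odd n \<longrightarrow>
      real (min_rev_dynamo (torus_verts d n) (torus_adj d n) r)
        \<le> 1 / real r * real (d choose (r - 1)) * real n ^ (r - 1)
          + C * real n powi (int r - 2))"
\<comment> \<open>The constant comes from the size of the frame, and 3 is the least length at which
  opposite steps differ.\<close>
proof (intro exI[of _ "2 ^ d * 4 ^ d :: real"] exI[of _ "3 :: nat"] conjI allI impI)
  fix n :: nat assume n: "n \<ge> 3" "odd n"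
  let ?m = "min_rev_dynamo (torus_verts d n) (torus_adj d n) r"
  show "real ?m \<le> 1 / real r * real (d choose (r - 1)) * real n ^ (r - 1)
      + 2 ^ d * 4 ^ d * real n powi (int r - 2)"
  proof (cases "r = 1")
    case True
    have "?m \<le> 1" using min_rev_dynamo_torus_1[OF n assms(1)] True by simp
    moreover have "0 \<le> 2 ^ d * 4 ^ d * real n powi (int r - 2)" by simp
    moreover have "1 / real r * real (d choose (r - 1)) * real n ^ (r - 1) = 1" using True by simp
    ultimately show ?thesis by linarith
  next
    case False
    then have r: "2 \<le> r" using assms by simp
    \<comment> \<open>The integer exponent is -1 for \<open>r = 1\<close>; from \<open>r = 2\<close>
      on it is an ordinary power.\<close>
    have pw: "real n powi (int r - 2) = real n ^ (r - 2)"
      using r by (metis of_nat_diff of_nat_numeral power_int_of_nat)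
    have "real (r * ?m) \<le> real ((d choose (r - 1)) * n ^ (r - 1) + r * (2 ^ d * 4 ^ d * n ^ (r - 2)))"
      using min_rev_dynamo_torus_le[OF n r assms(3)] by (simp only: of_nat_le_iff)
    then have "real r * real ?m \<le> real (d choose (r - 1)) * real n ^ (r - 1)
        + real r * (2 ^ d * 4 ^ d * real n ^ (r - 2))" by simp
    then show ?thesis unfolding pw using r by (simp add: field_simps)
  qed
qed simp

end
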